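(* Let $\Lambda$ be a monotone modal logic which is $\sigma$-canonical or $\pi$-canonical and which is preserved under bisimulation products. Then $\Lambda$ has the Lyndon interpolation property (LIP).
   Context: Formulas. Fix a countably infinite set $\mathcal V$ of propositional variables. A literal is a variable $p$ or its negation $\neg p$. Modal formulas (set $\mathrm{Fm}$) are built from literals and $\bot,\top$ using $\wedge,\vee,\Diamond,\Box$; negation of an arbitrary formula is defined by the duality laws, and $\varphi\to\psi$ is $\neg\varphi\vee\psi$. $\mathrm{lits}(\varphi)$ is the set of literals occurring in $\varphi$ (so $\mathrm{lits}(\neg p)=\{\neg p\}$). Logics. A modal logic is a set $\Lambda\subseteq\mathrm{Fm}$ containing all classical tautologies and closed under modus ponens, uniform substitution and the rule: from $\varphi\leftrightarrow\psi$ infer $\Diamond\varphi\leftrightarrow\Diamond\psi$. $\Lambda\vdash\varphi$ means $\varphi\in\Lambda$. $\Lambda$ is monotone if it contains $\Diamond p\to\Diamond(p\vee q)$. LIP. $\Lambda$ has LIP if whenever $\Lambda\vdash\varphi\to\psi$ there is a formula $\iota$ with $\mathrm{lits}(\iota)\subseteq\mathrm{lits}(\varphi)\cap\mathrm{lits}(\psi)$, $\Lambda\vdash\varphi\to\iota$ and $\Lambda\vdash\iota\to\psi$. Neighborhood frames. A neighborhood frame is a pair $\mathfrak F=(W,\Diamond)$ with $\Diamond:\mathcal P(W)\to\mathcal P(W)$; $\Box X=W\setminus\Diamond(W\setminus X)$. A valuation $\vartheta:\mathcal V\to\mathcal P(W)$ extends to all formulas, interpreting the Boolean connectives set-theoretically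 and $\Diamond,\Box$ by these operators. $\varphi$ is valid in $\mathfrak F$ if $\vartheta(\varphi)=W$ for all $\vartheta$; $\mathfrak F$ is a $\Lambda$-frame if all formulas of $\Lambda$ are valid in it. $\mathfrak F$ is monotone if $X\subseteq Y$ implies $\Diamond X\subseteq\Diamond Y$. Bisimulation products. For $Z\subseteq W_1\times W_2$, $Z(X_1)$ denotes the image of $X_1\subseteq W_1$ and $Z^{-1}(X_2)$ the preimage of $X_2\subseteq W_2$; $Z$ is full if $Z^{-1}(W_2)=W_1$ and $Z(W_1)=W_2$. $Z$ is a bisimulation between monotone frames $\mathfrak F_k=(W_k,\Diamond_k)$, $k=1,2$, if $Z(\Diamond_1X_1)\subseteq\Diamond_2Z(X_1)$ for all $X_1\subseteq W_1$ and $Z^{-1}(\Diamond_2X_2)\subseteq\Diamond_1Z^{-1}(X_2)$ for all $X_2\subseteq W_2$. If $Z$ is a full bisimulation, a frame $\mathfrak F=(Z,\Diamond)$ is a bisimulation product of $\mathfrak F_1$ and $\mathfrak F_2$ if for $k=1,2$ and all $X_k\subseteq W_k$, $\Diamond\pi_k^{-1}(X_k)=\pi_k^{-1}(\Diamond_kX_k)$, where $\pi_k:Z\to W_k$, $(w_1,w_2)\mapsto w_k$. $\Lambda$ is preserved under bisimulation products if for every full bisimulation $Z$ between $\Lambda$-frames $\mathfrak F_1,\mathfrak F_2$ there is an operator $\Diamond$ on $\mathcal P(Z)$ such that $(Z,\Diamond)$ is a bisimulation product of $\mathfrak F_1$ and $\mathfrak F_2$ and is a $\Lambda$-frame. Canonicity.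 For a monotone logic $\Lambda$, $\Gamma\subseteq\mathrm{Fm}$ is $\Lambda$-consistent if there is no finite $\Gamma_0\subseteq\Gamma$ with $\Lambda\vdash\bigwedge\Gamma_0\to\bot$. $W_\Lambda$ is the collection of all maximal $\Lambda$-consistent sets; for $\Gamma\subseteq\mathrm{Fm}$, $[\![\Gamma]\!]=\{w\in W_\Lambda\mid\Gamma\subseteq w\}$ and $[\![\varphi]\!]=[\![\{\varphi\}]\!]$. For $X\subseteq W_\Lambda$ (with $\Gamma$ ranging over sets of formulas, $\varphi$ over formulas, and $-Y=W_\Lambda\setminus Y$), $$\Diamond^\sigma_\Lambda X=\bigcup_{\Gamma:[\![\Gamma]\!]\subseteq X}\ \bigcap_{\varphi:[\![\Gamma]\!]\subseteq[\![\varphi]\!]}[\![\Diamond\varphi]\!],\qquad \Diamond^\pi_\Lambda X=\bigcap_{\Gamma:X\subseteq-[\![\Gamma]\!]}\ \bigcup_{\varphi:[\![\varphi]\!]\subseteq-[\![\Gamma]\!]}[\![\Diamond\varphi]\!].$$ $\mathfrak F^\sigma_\Lambda=(W_\Lambda,\Diamond^\pi_\Lambda)$ and $\mathfrak F^\pi_\Lambda=(W_\Lambda,\Diamond^\sigma_\Lambda)$ (the interchange of superscripts is intended). $\Lambda$ is $\sigma$-canonical if $\mathfrak F^\sigma_\Lambda$ is a $\Lambda$-frame, and $\pi$-canonical if $\mathfrak F^\pi_\Lambda$ is a $\Lambda$-frame. *)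

theory Defs
  imports Main
begin

text \<open>The countably infinite set of propositional variables is \<^typ>\<open>nat\<close>.\<close>

datatype fm =
    Pos nat
  | Neg nat
  | Bot
  | Top
  | And fm fm
  | Or fm fm
  | Dia fm
  | Box fm

primrec neg :: "fm \<Rightarrow> fm" where
  "neg (Pos p) = Neg p"
| "neg (Neg p) = Pos p"
| "neg Bot = Top"
| "neg Top = Bot"
| "neg (And \<phi> \<psi>) = Or (neg \<phi>) (neg \<psi>)"
| "neg (Or \<phi> \<psi>) = And (neg \<phi>) (neg \<psi>)"
| "neg (Dia \<phi>) = Box (neg \<phi>)"
| "neg (Box \<phi>) = Dia (neg \<phi>)"

definition imp :: "fm \<Rightarrow> fm \<Rightarrow> fm" where
  "imp \<phi> \<psi> = Or (neg \<phi>) \<psi>"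

definition equ :: "fm \<Rightarrow> fm \<Rightarrow> fm" where
  "equ \<phi> \<psi> = And (imp \<phi> \<psi>) (imp \<psi> \<phi>)"

text \<open>A literal is represented by the corresponding formula.\<close>

primrec lits :: "fm \<Rightarrow> fm set" where
  "lits (Pos p) = {Pos p}"
| "lits (Neg p) = {Neg p}"
| "lits Bot = {}"
| "lits Top = {}"
| "lits (And \<phi> \<psi>) = lits \<phi> \<union> lits \<psi>"
| "lits (Or \<phi> \<psi>) = lits \<phi> \<union> lits \<psi>"
| "lits (Dia \<phi>) = lits \<phi>"
| "lits (Box \<phi>) = lits \<phi>"

primrec subst :: "(nat \<Rightarrow> fm) \<Rightarrow> fm \<Rightarrow> fm" where
  "subst s (Pos p) = s p"
| "subst s (Neg p) = neg (s p)"
| "subst s Bot = Bot"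
| "subst s Top = Top"
| "subst s (And \<phi> \<psi>) = And (subst s \<phi>) (subst s \<psi>)"
| "subst s (Or \<phi> \<psi>) = Or (subst s \<phi>) (subst s \<psi>)"
| "subst s (Dia \<phi>) = Dia (subst s \<phi>)"
| "subst s (Box \<phi>) = Box (subst s \<phi>)"

text \<open>Classical truth-value assignments: the variables and the formulas \<open>Dia \<phi>\<close> are the atoms
  (with values \<open>v p\<close> and \<open>d \<phi>\<close>). As \<open>Box \<phi>\<close> is the negation of \<open>Dia (neg \<phi>)\<close>, it receives the
  opposite value of the latter. Hence the tautologies are the substitution instances of
  modality-free propositional tautologies.\<close>

primrec truth :: "(nat \<Rightarrow> bool) \<Rightarrow> (fm \<Rightarrow> bool) \<Rightarrow> fm \<Rightarrow> bool" where
  "truth v d (Pos p) \<longleftrightarrow> v p"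
| "truth v d (Neg p) \<longleftrightarrow> \<not> v p"
| "truth v d Bot \<longleftrightarrow> False"
| "truth v d Top \<longleftrightarrow> True"
| "truth v d (And \<phi> \<psi>) \<longleftrightarrow> truth v d \<phi> \<and> truth v d \<psi>"
| "truth v d (Or \<phi> \<psi>) \<longleftrightarrow> truth v d \<phi> \<or> truth v d \<psi>"
| "truth v d (Dia \<phi>) \<longleftrightarrow> d \<phi>"
| "truth v d (Box \<phi>) \<longleftrightarrow> \<not> d (neg \<phi>)"

definition tautology :: "fm \<Rightarrow> bool" where
  "tautology \<phi> \<longleftrightarrow> (\<forall>v d. truth v d \<phi>)"

definition modal_logic :: "fm set \<Rightarrow> bool" where
  "modal_logic \<Lambda> \<longleftrightarrow>
     (\<forall>\<phi>. tautology \<phi> \<longrightarrow> \<phi> \<in> \<Lambda>) \<and>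
     (\<forall>\<phi> \<psi>. \<phi> \<in> \<Lambda> \<longrightarrow> imp \<phi> \<psi> \<in> \<Lambda> \<longrightarrow> \<psi> \<in> \<Lambda>) \<and>
     (\<forall>s \<phi>. \<phi> \<in> \<Lambda> \<longrightarrow> subst s \<phi> \<in> \<Lambda>) \<and>
     (\<forall>\<phi> \<psi>. equ \<phi> \<psi> \<in> \<Lambda> \<longrightarrow> equ (Dia \<phi>) (Dia \<psi>) \<in> \<Lambda>)"

definition monotone_logic :: "fm set \<Rightarrow> bool" where
  "monotone_logic \<Lambda> \<longleftrightarrow>
     modal_logic \<Lambda> \<and> imp (Dia (Pos 0)) (Dia (Or (Pos 0) (Pos 1))) \<in> \<Lambda>"

definition LIP :: "fm set \<Rightarrow> bool" where
  "LIP \<Lambda> \<longleftrightarrow>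
     (\<forall>\<phi> \<psi>. imp \<phi> \<psi> \<in> \<Lambda> \<longrightarrow>
        (\<exists>\<iota>. lits \<iota> \<subseteq> lits \<phi> \<inter> lits \<psi> \<and> imp \<phi> \<iota> \<in> \<Lambda> \<and> imp \<iota> \<psi> \<in> \<Lambda>))"


text \<open>A frame consists of a carrier \<open>W\<close> and a total HOL function on sets, of which only the
  restriction to subsets of \<open>W\<close> matters; \<open>nbhd_frame\<close> says that it is an operator on the
  powerset of \<open>W\<close>.\<close>

type_synonym 'w frame = "'w set \<times> ('w set \<Rightarrow> 'w set)"

abbreviation worlds :: "'w frame \<Rightarrow> 'w set" where
  "worlds F \<equiv> fst F"

abbreviation dia :: "'w frame \<Rightarrow> 'w set \<Rightarrow> 'w set" where
  "dia F \<equiv> snd F"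

definition nbhd_frame :: "'w frame \<Rightarrow> bool" where
  "nbhd_frame F \<longleftrightarrow> (\<forall>X \<subseteq> worlds F. dia F X \<subseteq> worlds F)"

definition box :: "'w frame \<Rightarrow> 'w set \<Rightarrow> 'w set" where
  "box F X = worlds F - dia F (worlds F - X)"

primrec ext :: "'w frame \<Rightarrow> (nat \<Rightarrow> 'w set) \<Rightarrow> fm \<Rightarrow> 'w set" where
  "ext F \<theta> (Pos p) = \<theta> p"
| "ext F \<theta> (Neg p) = worlds F - \<theta> p"
| "ext F \<theta> Bot = {}"
| "ext F \<theta> Top = worlds F"
| "ext F \<theta> (And \<phi> \<psi>) = ext F \<theta> \<phi> \<inter> ext F \<theta> \<psi>"
| "ext F \<theta> (Or \<phi> \<psi>) = ext F \<theta> \<phi> \<union> ext F \<theta> \<psi>"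
| "ext F \<theta> (Dia \<phi>) = dia F (ext F \<theta> \<phi>)"
| "ext F \<theta> (Box \<phi>) = box F (ext F \<theta> \<phi>)"

definition valid_in :: "'w frame \<Rightarrow> fm \<Rightarrow> bool" where
  "valid_in F \<phi> \<longleftrightarrow> (\<forall>\<theta>. (\<forall>p. \<theta> p \<subseteq> worlds F) \<longrightarrow> ext F \<theta> \<phi> = worlds F)"

definition logic_frame :: "fm set \<Rightarrow> 'w frame \<Rightarrow> bool" where
  "logic_frame \<Lambda> F \<longleftrightarrow> nbhd_frame F \<and> (\<forall>\<phi>\<in>\<Lambda>. valid_in F \<phi>)"

definition monotone_frame :: "'w frame \<Rightarrow> bool" where
  "monotone_frame F \<longleftrightarrow>
     nbhd_frame F \<and> (\<forall>X Y. X \<subseteq> Y \<longrightarrow> Y \<subseteq> worlds F \<longrightarrow> dia F X \<subseteq> dia F Y)"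


definition bisimulation :: "('a \<times> 'b) set \<Rightarrow> 'a frame \<Rightarrow> 'b frame \<Rightarrow> bool" where
  "bisimulation Z F1 F2 \<longleftrightarrow>
     monotone_frame F1 \<and> monotone_frame F2 \<and> Z \<subseteq> worlds F1 \<times> worlds F2 \<and>
     (\<forall>X \<subseteq> worlds F1. Z `` dia F1 X \<subseteq> dia F2 (Z `` X)) \<and>
     (\<forall>X \<subseteq> worlds F2. Z\<inverse> `` dia F2 X \<subseteq> dia F1 (Z\<inverse> `` X))"

definition full_bisimulation :: "('a \<times> 'b) set \<Rightarrow> 'a frame \<Rightarrow> 'b frame \<Rightarrow> bool" where
  "full_bisimulation Z F1 F2 \<longleftrightarrow>
     bisimulation Z F1 F2 \<and> Z\<inverse> `` worlds F2 = worlds F1 \<and> Z `` worlds F1 = worlds F2"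

definition bisim_product ::
  "('a \<times> 'b) frame \<Rightarrow> ('a \<times> 'b) set \<Rightarrow> 'a frame \<Rightarrow> 'b frame \<Rightarrow> bool" where
  "bisim_product F Z F1 F2 \<longleftrightarrow>
     full_bisimulation Z F1 F2 \<and> nbhd_frame F \<and> worlds F = Z \<and>
     (\<forall>X \<subseteq> worlds F1. dia F {z \<in> Z. fst z \<in> X} = {z \<in> Z. fst z \<in> dia F1 X}) \<and>
     (\<forall>X \<subseteq> worlds F2. dia F {z \<in> Z. snd z \<in> X} = {z \<in> Z. snd z \<in> dia F2 X})"

text \<open>HOL cannot quantify over types inside a formula, so the type \<open>'w\<close> from which the worlds
  of the two frames are drawn (with arbitrary carriers) is a parameter. Preservation for the class
  of all frames implies \<open>preserved_bisim_products TYPE('w) \<Lambda>\<close> for every \<open>'w\<close>; assuming the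
  latter for one particular \<open>'w\<close> is thus the weaker hypothesis.\<close>

definition preserved_bisim_products :: "'w itself \<Rightarrow> fm set \<Rightarrow> bool" where
  "preserved_bisim_products _ \<Lambda> \<longleftrightarrow>
     (\<forall>(F1 :: 'w frame) (F2 :: 'w frame) Z.
        logic_frame \<Lambda> F1 \<longrightarrow> logic_frame \<Lambda> F2 \<longrightarrow> full_bisimulation Z F1 F2 \<longrightarrow>
        (\<exists>D. bisim_product (Z, D) Z F1 F2 \<and> logic_frame \<Lambda> (Z, D)))"


text \<open>Finite subsets are given by enumerating lists; order and repetitions are irrelevant up to
  provable equivalence.\<close>

definition conj :: "fm list \<Rightarrow> fm" where
  "conj \<phi>s = foldr And \<phi>s Top"

definition consistent :: "fm set \<Rightarrow> fm set \<Rightarrow> bool" where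
  "consistent \<Lambda> \<Gamma> \<longleftrightarrow> \<not> (\<exists>\<phi>s. set \<phi>s \<subseteq> \<Gamma> \<and> imp (conj \<phi>s) Bot \<in> \<Lambda>)"

definition can_worlds :: "fm set \<Rightarrow> fm set set" where
  "can_worlds \<Lambda> = {w. consistent \<Lambda> w \<and> (\<forall>w'. w \<subset> w' \<longrightarrow> \<not> consistent \<Lambda> w')}"

definition ext_set :: "fm set \<Rightarrow> fm set \<Rightarrow> fm set set" where
  "ext_set \<Lambda> \<Gamma> = {w \<in> can_worlds \<Lambda>. \<Gamma> \<subseteq> w}"

abbreviation ext_fm :: "fm set \<Rightarrow> fm \<Rightarrow> fm set set" where
  "ext_fm \<Lambda> \<phi> \<equiv> ext_set \<Lambda> {\<phi>}"

text \<open>For a modal logic \<open>\<Lambda>\<close> and \<open>X \<subseteq> can_worlds \<Lambda>\<close> the intersections below are over nonempty index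
  sets (witnessed by \<open>Top\<close> and \<open>{Bot}\<close>, respectively), so both values are subsets of
  \<open>can_worlds \<Lambda>\<close>.\<close>

definition dia_sigma :: "fm set \<Rightarrow> fm set set \<Rightarrow> fm set set" where
  "dia_sigma \<Lambda> X =
     (\<Union>\<Gamma>\<in>{\<Gamma>. ext_set \<Lambda> \<Gamma> \<subseteq> X}. \<Inter>\<phi>\<in>{\<phi>. ext_set \<Lambda> \<Gamma> \<subseteq> ext_fm \<Lambda> \<phi>}. ext_fm \<Lambda> (Dia \<phi>))"

definition dia_pi :: "fm set \<Rightarrow> fm set set \<Rightarrow> fm set set" where
  "dia_pi \<Lambda> X =
     (\<Inter>\<Gamma>\<in>{\<Gamma>. X \<subseteq> can_worlds \<Lambda> - ext_set \<Lambda> \<Gamma>}.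
        \<Union>\<phi>\<in>{\<phi>. ext_fm \<Lambda> \<phi> \<subseteq> can_worlds \<Lambda> - ext_set \<Lambda> \<Gamma>}. ext_fm \<Lambda> (Dia \<phi>))"

text \<open>The interchange of \<open>\<sigma>\<close> and \<open>\<pi>\<close> between frames and operators is intended.\<close>

definition frame_sigma :: "fm set \<Rightarrow> fm set frame" where
  "frame_sigma \<Lambda> = (can_worlds \<Lambda>, dia_pi \<Lambda>)"

definition frame_pi :: "fm set \<Rightarrow> fm set frame" where
  "frame_pi \<Lambda> = (can_worlds \<Lambda>, dia_sigma \<Lambda>)"

definition sigma_canonical :: "fm set \<Rightarrow> bool" where
  "sigma_canonical \<Lambda> \<longleftrightarrow> logic_frame \<Lambda> (frame_sigma \<Lambda>)"

definition pi_canonical :: "fm set \<Rightarrow> bool" where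
  "pi_canonical \<Lambda> \<longleftrightarrow> logic_frame \<Lambda> (frame_pi \<Lambda>)"

end

theory Submission
  imports Defs
begin

text \<open>
  Suppose \<open>\<phi> \<rightarrow> \<psi>\<close> is in \<open>\<Lambda>\<close> but has no interpolant over the literals \<open>L = lits \<phi> \<inter> lits \<psi>\<close>. Take
  both factors of a bisimulation product to be the canonical frame that is a \<open>\<Lambda>\<close>-frame, and let \<open>Z\<close>
  (\<open>lit_sim\<close>) relate a world \<open>u\<close> to a world \<open>v\<close> if every formula over \<open>L\<close> in \<open>u\<close> also belongs to \<open>v\<close>. Unlike the
  relation used for Craig interpolation, this one need not be symmetric. It is nevertheless a full
  bisimulation of frames: it is reflexive, and its converse is the relation of the same kind for the
  negated literals, so only one of the two bisimulation inclusions has to be checked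
  (\<open>lit_sim_converse\<close>, \<open>lit_sim_dia_sigma\<close>, \<open>lit_sim_dia_pi\<close>). The inclusion holds because a closed set of worlds
  \<open>\<lbrakk>\<Gamma>\<rbrakk>\<close> has as its image the closed set of the consequences of \<open>\<Gamma>\<close> over \<open>L\<close>, and because, by
  compactness and monotonicity, \<open>\<Diamond>\<close> only has to be tested on single formulas over \<open>L\<close>.

  As no interpolant exists, there is a related pair \<open>(w\<^sub>1, w\<^sub>2)\<close> with \<open>\<phi> \<in> w\<^sub>1\<close> and \<open>\<psi> \<notin> w\<^sub>2\<close>
  (\<open>separating_pair\<close>). On a product over this relation, the definition of the relation leaves room
  for a valuation that lies above the first projection on the literals of \<open>\<phi>\<close> and below the second
  projection on the literals of \<open>\<psi>\<close>. The product operator is monotone and commutes with both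
  preimages, so these inclusions extend from literals to \<open>\<phi>\<close> and \<open>\<psi>\<close> themselves
  (\<open>ext_mono_lits\<close> and \<open>ext_preimage\<close>). Hence \<open>\<phi>\<close> is true and \<open>\<psi>\<close> is false at
  \<open>(w\<^sub>1, w\<^sub>2)\<close>, which contradicts the validity of \<open>\<phi> \<rightarrow> \<psi>\<close> in the product.
\<close>

section \<open>Formulas and derivability\<close>

lemma neg_neg [simp]: "neg (neg \<phi>) = \<phi>"
  by (induction \<phi>) auto

lemma lits_neg: "lits (neg \<phi>) = neg ` lits \<phi>"
  by (induction \<phi>) auto

lemma lits_neg_subset: "lits \<phi> \<subseteq> neg ` L \<longleftrightarrow> lits (neg \<phi>) \<subseteq> L"
proof -
  have "\<phi>' \<in> neg ` L \<longleftrightarrow> neg \<phi>' \<in> L" for \<phi>'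
    by (metis imageE image_eqI neg_neg)
  then show ?thesis
    unfolding lits_neg by blast
qed

lemma truth_neg [simp]: "truth v d (neg \<phi>) \<longleftrightarrow> \<not> truth v d \<phi>"
  by (induction \<phi>) auto

lemma truth_imp [simp]: "truth v d (imp \<phi> \<psi>) \<longleftrightarrow> (truth v d \<phi> \<longrightarrow> truth v d \<psi>)"
  by (simp add: imp_def)

lemma truth_conj [simp]: "truth v d (conj \<phi>s) \<longleftrightarrow> (\<forall>\<phi>\<in>set \<phi>s. truth v d \<phi>)"
  by (induction \<phi>s) (auto simp: conj_def)

lemma lits_conj: "lits (conj \<phi>s) = (\<Union>\<phi>\<in>set \<phi>s. lits \<phi>)"
  by (induction \<phi>s) (auto simp: conj_def)

definition derives :: "fm set \<Rightarrow> fm set \<Rightarrow> fm \<Rightarrow> bool" where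
  "derives \<Lambda> \<Gamma> \<phi> \<longleftrightarrow> (\<exists>\<phi>s. set \<phi>s \<subseteq> \<Gamma> \<and> imp (conj \<phi>s) \<phi> \<in> \<Lambda>)"

lemma consistent_iff: "consistent \<Lambda> \<Gamma> \<longleftrightarrow> \<not> derives \<Lambda> \<Gamma> Bot"
  by (simp add: consistent_def derives_def)

lemma derives_weaken: "derives \<Lambda> \<Gamma> \<phi> \<Longrightarrow> \<Gamma> \<subseteq> \<Delta> \<Longrightarrow> derives \<Lambda> \<Delta> \<phi>"
  by (auto simp: derives_def)

definition lit_sim :: "fm set \<Rightarrow> fm set \<Rightarrow> (fm set \<times> fm set) set" where
  "lit_sim \<Lambda> L =
     {(u, v). u \<in> can_worlds \<Lambda> \<and> v \<in> can_worlds \<Lambda> \<and> (\<forall>\<chi>. lits \<chi> \<subseteq> L \<longrightarrow> \<chi> \<in> u \<longrightarrow> \<chi> \<in> v)}"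

lemmas
  modal_logic_tautology = modal_logic_def[THEN iffD1, THEN conjunct1, rule_format] and
  modal_logic_mp = modal_logic_def[THEN iffD1, THEN conjunct2, THEN conjunct1, rule_format] and
  modal_logic_subst =
    modal_logic_def[THEN iffD1, THEN conjunct2, THEN conjunct2, THEN conjunct1, rule_format] and
  modal_logic_equ_Dia =
    modal_logic_def[THEN iffD1, THEN conjunct2, THEN conjunct2, THEN conjunct2, rule_format]

context
  fixes \<Lambda> :: "fm set"
  assumes monotone: "monotone_logic \<Lambda>"
begin

lemma modal: "modal_logic \<Lambda>"
  using monotone by (simp add: monotone_logic_def)

lemma tautology_mem: "(\<And>v d. truth v d \<phi>) \<Longrightarrow> \<phi> \<in> \<Lambda>"
  by (rule modal_logic_tautology[OF modal]) (simp add: tautology_def)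

lemma tautological_consequence:
  assumes "\<alpha> \<in> \<Lambda>" "\<beta> \<in> \<Lambda>" "\<And>v d. truth v d \<alpha> \<Longrightarrow> truth v d \<beta> \<Longrightarrow> truth v d \<gamma>"
  shows "\<gamma> \<in> \<Lambda>"
proof -
  have "imp \<alpha> (imp \<beta> \<gamma>) \<in> \<Lambda>"
    by (rule tautology_mem) (use assms(3) in auto)
  then show ?thesis
    using modal_logic_mp[OF modal] assms(1,2) by metis
qed

lemma imp_Dia_mem:
  assumes "imp \<phi> \<psi> \<in> \<Lambda>"
  shows "imp (Dia \<phi>) (Dia \<psi>) \<in> \<Lambda>"
proof -
  have "subst (\<lambda>p. if p = 0 then \<phi> else \<psi>) (imp (Dia (Pos 0)) (Dia (Or (Pos 0) (Pos 1)))) \<in> \<Lambda>"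
    by (rule modal_logic_subst[OF modal]) (use monotone in \<open>simp add: monotone_logic_def\<close>)
  then have *: "imp (Dia \<phi>) (Dia (Or \<phi> \<psi>)) \<in> \<Lambda>"
    by (simp add: imp_def)
  have "equ (Or \<phi> \<psi>) \<psi> \<in> \<Lambda>"
    by (rule tautological_consequence[OF assms assms]) (auto simp: equ_def)
  then have "equ (Dia (Or \<phi> \<psi>)) (Dia \<psi>) \<in> \<Lambda>"
    by (rule modal_logic_equ_Dia[OF modal])
  with * show ?thesis
    by (rule tautological_consequence) (auto simp: equ_def)
qed

lemma derives_tautological_consequence:
  assumes "derives \<Lambda> \<Gamma> \<alpha>" "derives \<Lambda> \<Gamma> \<beta>"
    and "\<And>v d. truth v d \<alpha> \<Longrightarrow> truth v d \<beta> \<Longrightarrow> truth v d \<gamma>"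
  shows "derives \<Lambda> \<Gamma> \<gamma>"
proof -
  obtain as bs where "set as \<subseteq> \<Gamma>" "imp (conj as) \<alpha> \<in> \<Lambda>" "set bs \<subseteq> \<Gamma>" "imp (conj bs) \<beta> \<in> \<Lambda>"
    using assms(1,2) by (auto simp: derives_def)
  moreover from this(2,4) have "imp (conj (as @ bs)) \<gamma> \<in> \<Lambda>"
    by (rule tautological_consequence) (use assms(3) in auto)
  ultimately show ?thesis
    unfolding derives_def by (intro exI[of _ "as @ bs"]) auto
qed

lemma derives_mem: "\<phi> \<in> \<Gamma> \<Longrightarrow> derives \<Lambda> \<Gamma> \<phi>"
  unfolding derives_def by (intro exI[of _ "[\<phi>]"]) (auto intro!: tautology_mem)

lemma derives_theorem: "\<phi> \<in> \<Lambda> \<Longrightarrow> derives \<Lambda> \<Gamma> \<phi>"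
  unfolding derives_def
  by (intro exI[of _ "[]"] conjI, simp, rule tautological_consequence[of \<phi> \<phi>]) auto

lemma derives_deduction:
  assumes "derives \<Lambda> (insert \<alpha> \<Gamma>) \<beta>"
  shows "derives \<Lambda> \<Gamma> (imp \<alpha> \<beta>)"
proof -
  obtain \<phi>s where \<phi>s: "set \<phi>s \<subseteq> insert \<alpha> \<Gamma>" "imp (conj \<phi>s) \<beta> \<in> \<Lambda>"
    using assms by (auto simp: derives_def)
  have "imp (conj (filter (\<lambda>\<phi>. \<phi> \<noteq> \<alpha>) \<phi>s)) (imp \<alpha> \<beta>) \<in> \<Lambda>"
    by (rule tautological_consequence[OF \<phi>s(2) \<phi>s(2)]) auto
  then show ?thesis
    unfolding derives_def using \<phi>s(1) by (intro exI[of _ "filter (\<lambda>\<phi>. \<phi> \<noteq> \<alpha>) \<phi>s"]) auto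
qed

lemma derives_singleton: "derives \<Lambda> {\<alpha>} \<beta> \<longleftrightarrow> imp \<alpha> \<beta> \<in> \<Lambda>"
proof
  assume "derives \<Lambda> {\<alpha>} \<beta>"
  then obtain \<phi>s where \<phi>s: "set \<phi>s \<subseteq> {\<alpha>}" "imp (conj \<phi>s) \<beta> \<in> \<Lambda>"
    by (auto simp: derives_def)
  show "imp \<alpha> \<beta> \<in> \<Lambda>"
    by (rule tautological_consequence[OF \<phi>s(2) \<phi>s(2)]) (use \<phi>s(1) in auto)
next
  assume imp: "imp \<alpha> \<beta> \<in> \<Lambda>"
  show "derives \<Lambda> {\<alpha>} \<beta>"
    by (rule derives_tautological_consequence[OF derives_mem[of \<alpha>] derives_theorem[OF imp]]) auto
qed

text \<open>The formulas over a fixed set of literals are closed under conjunction, so finitely many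
  premises of this kind can be merged into one.\<close>

lemma derives_from_consequences:
  assumes "derives \<Lambda> {\<chi>. lits \<chi> \<subseteq> L \<and> derives \<Lambda> \<Gamma> \<chi>} \<phi>"
  obtains \<chi> where "lits \<chi> \<subseteq> L" "derives \<Lambda> \<Gamma> \<chi>" "imp \<chi> \<phi> \<in> \<Lambda>"
proof -
  obtain \<phi>s where \<phi>s: "set \<phi>s \<subseteq> {\<chi>. lits \<chi> \<subseteq> L \<and> derives \<Lambda> \<Gamma> \<chi>}" "imp (conj \<phi>s) \<phi> \<in> \<Lambda>"
    using assms by (auto simp: derives_def)
  have "derives \<Lambda> \<Gamma> (conj \<phi>s)"
    using \<phi>s(1)
  proof (induction \<phi>s)
    case Nil
    show ?case
      by (rule derives_theorem, rule tautology_mem) simp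
  next
    case (Cons \<alpha> \<phi>s)
    then have "derives \<Lambda> \<Gamma> \<alpha>" "derives \<Lambda> \<Gamma> (conj \<phi>s)"
      by auto
    then show ?case
      by (rule derives_tautological_consequence) auto
  qed
  moreover have "lits (conj \<phi>s) \<subseteq> L"
    using \<phi>s(1) by (auto simp: lits_conj)
  ultimately show ?thesis
    using that \<phi>s(2) by blast
qed


section \<open>Maximal consistent sets\<close>

lemma world_above_consistent_set:
  assumes "\<not> derives \<Lambda> \<Gamma> Bot"
  obtains w where "w \<in> can_worlds \<Lambda>" "\<Gamma> \<subseteq> w"
proof -
  let ?A = "{\<Delta>. \<not> derives \<Lambda> \<Delta> Bot \<and> \<Gamma> \<subseteq> \<Delta>}"
  have "\<exists>M\<in>?A. \<forall>X\<in>?A. M \<subseteq> X \<longrightarrow> X = M"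
  proof (rule subset_Zorn_nonempty)
    show "?A \<noteq> {}"
      using assms by blast
  next
    fix C
    assume C: "C \<noteq> {}" "subset.chain ?A C"
    have members: "\<not> derives \<Lambda> \<Delta> Bot" "\<Gamma> \<subseteq> \<Delta>" if "\<Delta> \<in> C" for \<Delta>
      using C(2) that unfolding subset.chain_def by blast+
    have "\<not> derives \<Lambda> (\<Union>C) Bot"
    proof
      assume "derives \<Lambda> (\<Union>C) Bot"
      then obtain \<phi>s where \<phi>s: "set \<phi>s \<subseteq> \<Union>C" "imp (conj \<phi>s) Bot \<in> \<Lambda>"
        by (auto simp: derives_def)
      obtain \<Delta> where "\<Delta> \<in> C" "set \<phi>s \<subseteq> \<Delta>"
        by (rule finite_subset_Union_chain[OF finite_set \<phi>s(1) C(1,2)])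
      with \<phi>s(2) show False
        using members(1)[of \<Delta>] unfolding derives_def by blast
    qed
    moreover have "\<Gamma> \<subseteq> \<Union>C"
      using C(1) members(2) by blast
    ultimately show "\<Union>C \<in> ?A"
      by blast
  qed
  then obtain w where w: "w \<in> ?A" "\<forall>X\<in>?A. w \<subseteq> X \<longrightarrow> X = w"
    by (rule bexE)
  have "derives \<Lambda> w' Bot" if "w \<subset> w'" for w'
  proof (rule ccontr)
    assume "\<not> derives \<Lambda> w' Bot"
    then have "w' \<in> ?A"
      using w(1) that by blast
    then show False
      using w(2) that by blast
  qed
  with w(1) have "w \<in> can_worlds \<Lambda>"
    by (simp add: can_worlds_def consistent_iff)
  then show ?thesis
    using w(1) that by blast
qed

lemma insert_world_inconsistent:
  assumes "w \<in> can_worlds \<Lambda>" "\<phi> \<notin> w"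
  shows "derives \<Lambda> (insert \<phi> w) Bot"
proof -
  have "w \<subset> insert \<phi> w"
    using assms(2) by blast
  then show ?thesis
    using assms(1) by (simp add: can_worlds_def consistent_iff)
qed

lemma world_derives:
  assumes "w \<in> can_worlds \<Lambda>" "derives \<Lambda> w \<phi>"
  shows "\<phi> \<in> w"
proof (rule ccontr)
  assume "\<phi> \<notin> w"
  then have "derives \<Lambda> (insert \<phi> w) Bot"
    by (rule insert_world_inconsistent[OF assms(1)])
  from derives_tautological_consequence[OF derives_deduction[OF this] assms(2)]
  have "derives \<Lambda> w Bot"
    by simp
  then show False
    using assms(1) by (simp add: can_worlds_def consistent_iff)
qed

lemma world_Bot: "w \<in> can_worlds \<Lambda> \<Longrightarrow> Bot \<notin> w"
  using derives_mem[of Bot w] by (auto simp: can_worlds_def consistent_iff)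

lemma world_tautological_consequence:
  assumes "w \<in> can_worlds \<Lambda>" "\<alpha> \<in> w" "\<beta> \<in> w"
    and "\<And>v d. truth v d \<alpha> \<Longrightarrow> truth v d \<beta> \<Longrightarrow> truth v d \<gamma>"
  shows "\<gamma> \<in> w"
  using derives_tautological_consequence[OF derives_mem[OF assms(2)] derives_mem[OF assms(3)] assms(4)]
  by (rule world_derives[OF assms(1)])

lemma world_imp: "w \<in> can_worlds \<Lambda> \<Longrightarrow> imp \<alpha> \<beta> \<in> \<Lambda> \<Longrightarrow> \<alpha> \<in> w \<Longrightarrow> \<beta> \<in> w"
  using world_derives[of w \<beta>] derives_weaken[of \<Lambda> "{\<alpha>}" \<beta> w] by (simp add: derives_singleton)

lemma world_neg:
  assumes w: "w \<in> can_worlds \<Lambda>"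
  shows "neg \<phi> \<in> w \<longleftrightarrow> \<phi> \<notin> w"
proof
  assume *: "neg \<phi> \<in> w"
  show "\<phi> \<notin> w"
  proof
    assume "\<phi> \<in> w"
    then have "Bot \<in> w"
      by (rule world_tautological_consequence[OF w _ *]) simp
    then show False
      using world_Bot[OF w] by blast
  qed
next
  assume "\<phi> \<notin> w"
  then have "derives \<Lambda> (insert \<phi> w) Bot"
    by (rule insert_world_inconsistent[OF w])
  then have "derives \<Lambda> w (imp \<phi> Bot)"
    by (rule derives_deduction)
  from derives_tautological_consequence[OF this this, of "neg \<phi>"]
  have "derives \<Lambda> w (neg \<phi>)"
    by simp
  then show "neg \<phi> \<in> w"
    by (rule world_derives[OF w])
qed

lemma world_And:
  assumes w: "w \<in> can_worlds \<Lambda>"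
  shows "And \<alpha> \<beta> \<in> w \<longleftrightarrow> \<alpha> \<in> w \<and> \<beta> \<in> w"
proof
  assume *: "And \<alpha> \<beta> \<in> w"
  show "\<alpha> \<in> w \<and> \<beta> \<in> w"
    using world_tautological_consequence[OF w * *, of \<alpha>]
      world_tautological_consequence[OF w * *, of \<beta>] by simp
next
  assume *: "\<alpha> \<in> w \<and> \<beta> \<in> w"
  show "And \<alpha> \<beta> \<in> w"
    by (rule world_tautological_consequence[OF w conjunct1[OF *] conjunct2[OF *]]) simp
qed

lemma world_Or: "w \<in> can_worlds \<Lambda> \<Longrightarrow> Or \<alpha> \<beta> \<in> w \<longleftrightarrow> \<alpha> \<in> w \<or> \<beta> \<in> w"
  using world_And[of w "neg \<alpha>" "neg \<beta>"] world_neg[of w "Or \<alpha> \<beta>"] world_neg[of w \<alpha>] world_neg[of w \<beta>]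
  by auto

lemma world_Top: "w \<in> can_worlds \<Lambda> \<Longrightarrow> Top \<in> w"
  using world_neg[of w Bot] world_Bot[of w] by auto

lemma ext_set_subset_iff_derives: "ext_set \<Lambda> \<Gamma> \<subseteq> ext_fm \<Lambda> \<phi> \<longleftrightarrow> derives \<Lambda> \<Gamma> \<phi>"
proof
  assume "derives \<Lambda> \<Gamma> \<phi>"
  then show "ext_set \<Lambda> \<Gamma> \<subseteq> ext_fm \<Lambda> \<phi>"
    by (auto simp: ext_set_def intro: world_derives derives_weaken)
next
  assume sub: "ext_set \<Lambda> \<Gamma> \<subseteq> ext_fm \<Lambda> \<phi>"
  show "derives \<Lambda> \<Gamma> \<phi>"
  proof (rule ccontr)
    assume not: "\<not> derives \<Lambda> \<Gamma> \<phi>"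
    have "\<not> derives \<Lambda> (insert (neg \<phi>) \<Gamma>) Bot"
    proof
      assume "derives \<Lambda> (insert (neg \<phi>) \<Gamma>) Bot"
      then have "derives \<Lambda> \<Gamma> (imp (neg \<phi>) Bot)"
        by (rule derives_deduction)
      from derives_tautological_consequence[OF this this, of \<phi>] not show False
        by auto
    qed
    then obtain w where "w \<in> can_worlds \<Lambda>" "insert (neg \<phi>) \<Gamma> \<subseteq> w"
      by (rule world_above_consistent_set)
    then show False
      using sub world_neg[of w \<phi>] by (auto simp: ext_set_def)
  qed
qed

lemma ext_fm_neg: "ext_fm \<Lambda> (neg \<phi>) = can_worlds \<Lambda> - ext_fm \<Lambda> \<phi>"
  by (auto simp: ext_set_def world_neg)

lemma ext_fm_subset_compl_iff_derives:
  "ext_fm \<Lambda> \<phi> \<subseteq> can_worlds \<Lambda> - ext_set \<Lambda> \<Gamma> \<longleftrightarrow> derives \<Lambda> \<Gamma> (neg \<phi>)"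
  unfolding ext_set_subset_iff_derives[symmetric] ext_fm_neg by (auto simp: ext_set_def)

lemma ext_fm_subset_iff: "ext_fm \<Lambda> \<phi> \<subseteq> ext_fm \<Lambda> \<psi> \<longleftrightarrow> imp \<phi> \<psi> \<in> \<Lambda>"
  by (simp add: ext_set_subset_iff_derives derives_singleton)


section \<open>The directed bisimulation between canonical worlds\<close>

text \<open>A world can avoid a whole set of formulas that is closed under disjunction as soon as none of
  them follows from \<open>\<Gamma>\<close>: an inconsistency of \<open>\<Gamma>\<close> with finitely many of their negations would
  make \<open>\<Gamma>\<close> derive their disjunction.\<close>

lemma world_avoiding_ideal:
  assumes Bot: "Bot \<in> T" and Or: "\<And>\<alpha> \<beta>. \<alpha> \<in> T \<Longrightarrow> \<beta> \<in> T \<Longrightarrow> Or \<alpha> \<beta> \<in> T"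
    and not: "\<And>\<chi>. \<chi> \<in> T \<Longrightarrow> \<not> derives \<Lambda> \<Gamma> \<chi>"
  obtains w where "w \<in> can_worlds \<Lambda>" "\<Gamma> \<subseteq> w" "w \<inter> T = {}"
proof -
  have disj: "\<exists>\<chi>\<in>T. derives \<Lambda> \<Gamma> (Or \<chi> (conj \<phi>s))" if "set \<phi>s \<subseteq> \<Gamma> \<union> neg ` T" for \<phi>s
    using that
  proof (induction \<phi>s)
    case Nil
    have "derives \<Lambda> \<Gamma> (Or Bot (conj []))"
      by (rule derives_theorem, rule tautology_mem) simp
    with Bot show ?case
      by blast
  next
    case (Cons \<alpha> \<phi>s)
    then obtain \<chi> where \<chi>: "\<chi> \<in> T" "derives \<Lambda> \<Gamma> (Or \<chi> (conj \<phi>s))"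
      by auto
    consider "\<alpha> \<in> \<Gamma>" | \<tau> where "\<tau> \<in> T" "\<alpha> = neg \<tau>"
      using Cons.prems by auto
    then show ?case
    proof cases
      case 1
      have "derives \<Lambda> \<Gamma> (Or \<chi> (conj (\<alpha> # \<phi>s)))"
        by (rule derives_tautological_consequence[OF \<chi>(2) derives_mem[OF 1]]) auto
      with \<chi>(1) show ?thesis
        by blast
    next
      case 2
      have "derives \<Lambda> \<Gamma> (Or (Or \<tau> \<chi>) (conj (\<alpha> # \<phi>s)))"
        by (rule derives_tautological_consequence[OF \<chi>(2) \<chi>(2)]) (auto simp: 2)
      with Or[OF 2(1) \<chi>(1)] show ?thesis
        by blast
    qed
  qed
  have "\<exists>\<chi>\<in>T. derives \<Lambda> \<Gamma> \<chi>" if inconsistent: "derives \<Lambda> (\<Gamma> \<union> neg ` T) Bot"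
  proof -
    obtain \<phi>s where \<phi>s: "set \<phi>s \<subseteq> \<Gamma> \<union> neg ` T" "imp (conj \<phi>s) Bot \<in> \<Lambda>"
      using inconsistent by (auto simp: derives_def)
    obtain \<chi> where \<chi>: "\<chi> \<in> T" "derives \<Lambda> \<Gamma> (Or \<chi> (conj \<phi>s))"
      using disj[OF \<phi>s(1)] by blast
    have "derives \<Lambda> \<Gamma> \<chi>"
      by (rule derives_tautological_consequence[OF \<chi>(2) derives_theorem[OF \<phi>s(2)]]) auto
    with \<chi>(1) show ?thesis
      by blast
  qed
  then have "\<not> derives \<Lambda> (\<Gamma> \<union> neg ` T) Bot"
    using not by blast
  then obtain w where w: "w \<in> can_worlds \<Lambda>" "\<Gamma> \<union> neg ` T \<subseteq> w"
    by (rule world_above_consistent_set)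
  then have "w \<inter> T = {}"
    using world_neg[OF w(1)] by blast
  with w that show ?thesis
    by blast
qed

text \<open>This gives \<open>\<lbrakk>\<Gamma>'\<rbrakk> \<subseteq> Z(\<lbrakk>\<Gamma>\<rbrakk>)\<close> for the set \<open>\<Gamma>'\<close> of consequences of \<open>\<Gamma>\<close> over \<open>L\<close>: the formulas
  over \<open>L\<close> outside \<open>v\<close> are closed under disjunction because \<open>v\<close> is prime.\<close>

lemma lit_sim_predecessor:
  assumes v: "v \<in> can_worlds \<Lambda>" and sub: "{\<chi>. lits \<chi> \<subseteq> L \<and> derives \<Lambda> \<Gamma> \<chi>} \<subseteq> v"
  obtains u where "u \<in> ext_set \<Lambda> \<Gamma>" "(u, v) \<in> lit_sim \<Lambda> L"
proof -
  obtain u where "u \<in> can_worlds \<Lambda>" "\<Gamma> \<subseteq> u" "u \<inter> {\<chi>. lits \<chi> \<subseteq> L \<and> \<chi> \<notin> v} = {}"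
    by (rule world_avoiding_ideal[of "{\<chi>. lits \<chi> \<subseteq> L \<and> \<chi> \<notin> v}" \<Gamma>])
      (use v sub in \<open>auto simp: world_Bot world_Or\<close>)
  with v that show ?thesis
    by (auto simp: lit_sim_def ext_set_def)
qed

text \<open>Contraposition, since membership of negations in worlds is complementary.\<close>

lemma lit_sim_converse: "(lit_sim \<Lambda> L)\<inverse> = lit_sim \<Lambda> (neg ` L)"
proof -
  have "(\<forall>\<chi>. lits \<chi> \<subseteq> L \<longrightarrow> \<chi> \<in> u \<longrightarrow> \<chi> \<in> v) \<longleftrightarrow> (\<forall>\<chi>. lits \<chi> \<subseteq> neg ` L \<longrightarrow> \<chi> \<in> v \<longrightarrow> \<chi> \<in> u)"
    if "u \<in> can_worlds \<Lambda>" "v \<in> can_worlds \<Lambda>" for u v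
    using world_neg[OF that(1)] world_neg[OF that(2)] unfolding lits_neg_subset
    by (metis neg_neg)
  then show ?thesis
    by (auto simp: lit_sim_def)
qed

text \<open>If \<open>\<Gamma>\<close> witnesses \<open>u \<in> \<Diamond>X\<close>, its consequences over \<open>L\<close> witness \<open>v \<in> \<Diamond>Z(X)\<close>: each of their own
  consequences follows from a single formula \<open>\<chi>\<close> over \<open>L\<close>, and \<open>Dia \<chi>\<close>, being over \<open>L\<close> as well,
  is transferred from \<open>u\<close> to \<open>v\<close>.\<close>

lemma lit_sim_dia_sigma: "lit_sim \<Lambda> L `` dia_sigma \<Lambda> X \<subseteq> dia_sigma \<Lambda> (lit_sim \<Lambda> L `` X)"
proof
  fix v
  assume "v \<in> lit_sim \<Lambda> L `` dia_sigma \<Lambda> X"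
  then obtain u where uv: "(u, v) \<in> lit_sim \<Lambda> L" and u: "u \<in> dia_sigma \<Lambda> X"
    by blast
  have v: "v \<in> can_worlds \<Lambda>"
    using uv by (simp add: lit_sim_def)
  obtain \<Gamma> where \<Gamma>: "ext_set \<Lambda> \<Gamma> \<subseteq> X" "\<And>\<phi>. derives \<Lambda> \<Gamma> \<phi> \<Longrightarrow> Dia \<phi> \<in> u"
    using u by (auto simp: dia_sigma_def ext_set_subset_iff_derives) (auto simp: ext_set_def)
  let ?\<Gamma>' = "{\<chi>. lits \<chi> \<subseteq> L \<and> derives \<Lambda> \<Gamma> \<chi>}"
  have "ext_set \<Lambda> ?\<Gamma>' \<subseteq> lit_sim \<Lambda> L `` X"
  proof
    fix y
    assume "y \<in> ext_set \<Lambda> ?\<Gamma>'"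
    then obtain x where "x \<in> ext_set \<Lambda> \<Gamma>" "(x, y) \<in> lit_sim \<Lambda> L"
      using lit_sim_predecessor unfolding ext_set_def by blast
    with \<Gamma>(1) show "y \<in> lit_sim \<Lambda> L `` X"
      by blast
  qed
  moreover have "Dia \<phi> \<in> v" if \<phi>: "derives \<Lambda> ?\<Gamma>' \<phi>" for \<phi>
  proof -
    obtain \<chi> where \<chi>: "lits \<chi> \<subseteq> L" "derives \<Lambda> \<Gamma> \<chi>" "imp \<chi> \<phi> \<in> \<Lambda>"
      by (rule derives_from_consequences[OF \<phi>])
    have "Dia \<chi> \<in> v"
      using \<chi>(1) \<Gamma>(2)[OF \<chi>(2)] uv by (simp add: lit_sim_def)
    then show ?thesis
      using world_imp[OF v imp_Dia_mem[OF \<chi>(3)]] by blast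
  qed
  ultimately show "v \<in> dia_sigma \<Lambda> (lit_sim \<Lambda> L `` X)"
    unfolding dia_sigma_def ext_set_subset_iff_derives using v by (auto simp: ext_set_def)
qed

text \<open>Dually, a closed set disjoint from \<open>Z(X)\<close> is pulled back along \<open>Z\<close> to a closed set disjoint
  from \<open>X\<close>; pulling back is taking consequences over the negated literals.\<close>

lemma lit_sim_dia_pi:
  assumes X: "X \<subseteq> can_worlds \<Lambda>"
  shows "lit_sim \<Lambda> L `` dia_pi \<Lambda> X \<subseteq> dia_pi \<Lambda> (lit_sim \<Lambda> L `` X)"
proof
  fix v
  assume "v \<in> lit_sim \<Lambda> L `` dia_pi \<Lambda> X"
  then obtain u where uv: "(u, v) \<in> lit_sim \<Lambda> L" and u: "u \<in> dia_pi \<Lambda> X"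
    by blast
  have v: "v \<in> can_worlds \<Lambda>"
    using uv by (simp add: lit_sim_def)
  have "\<exists>\<phi>. derives \<Lambda> \<Gamma> (neg \<phi>) \<and> Dia \<phi> \<in> v"
    if \<Gamma>: "lit_sim \<Lambda> L `` X \<subseteq> can_worlds \<Lambda> - ext_set \<Lambda> \<Gamma>" for \<Gamma>
  proof -
    let ?\<Gamma>' = "{\<chi>. lits \<chi> \<subseteq> neg ` L \<and> derives \<Lambda> \<Gamma> \<chi>}"
    have "x \<notin> ext_set \<Lambda> ?\<Gamma>'" if "x \<in> X" for x
    proof
      assume "x \<in> ext_set \<Lambda> ?\<Gamma>'"
      then obtain y where "y \<in> ext_set \<Lambda> \<Gamma>" "(y, x) \<in> lit_sim \<Lambda> (neg ` L)"
        using lit_sim_predecessor unfolding ext_set_def by blast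
      with \<Gamma> \<open>x \<in> X\<close> show False
        unfolding lit_sim_converse[symmetric] by blast
    qed
    then have "X \<subseteq> can_worlds \<Lambda> - ext_set \<Lambda> ?\<Gamma>'"
      using X by blast
    then obtain \<phi> where \<phi>: "derives \<Lambda> ?\<Gamma>' (neg \<phi>)" "Dia \<phi> \<in> u"
      using u unfolding dia_pi_def ext_fm_subset_compl_iff_derives by (auto simp: ext_set_def)
    obtain \<chi> where \<chi>: "lits \<chi> \<subseteq> neg ` L" "derives \<Lambda> \<Gamma> \<chi>" "imp \<chi> (neg \<phi>) \<in> \<Lambda>"
      by (rule derives_from_consequences[OF \<phi>(1)])
    have "imp \<phi> (neg \<chi>) \<in> \<Lambda>"
      by (rule tautological_consequence[OF \<chi>(3) \<chi>(3)]) auto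
    then have "Dia (neg \<chi>) \<in> u"
      using imp_Dia_mem world_imp \<phi>(2) uv by (blast dest: lit_sim_def[THEN equalityD1, THEN subsetD])
    moreover have "lits (Dia (neg \<chi>)) \<subseteq> L"
      using \<chi>(1) by (simp add: lits_neg_subset)
    ultimately have "Dia (neg \<chi>) \<in> v"
      using uv unfolding lit_sim_def by blast
    with \<chi>(2) show ?thesis
      by (intro exI[of _ "neg \<chi>"]) simp
  qed
  then show "v \<in> dia_pi \<Lambda> (lit_sim \<Lambda> L `` X)"
    unfolding dia_pi_def ext_fm_subset_compl_iff_derives using v by (auto simp: ext_set_def)
qed

text \<open>The formulas over \<open>L\<close> that follow from \<open>\<phi>\<close> do not derive \<open>\<psi>\<close>, for otherwise one of them
  would be an interpolant.\<close>

lemma separating_pair: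
  assumes no_interpolant: "\<And>\<iota>. lits \<iota> \<subseteq> L \<Longrightarrow> imp \<phi> \<iota> \<in> \<Lambda> \<Longrightarrow> imp \<iota> \<psi> \<notin> \<Lambda>"
  obtains u v where "(u, v) \<in> lit_sim \<Lambda> L" "\<phi> \<in> u" "\<psi> \<notin> v"
proof -
  let ?\<Gamma> = "{\<chi>. lits \<chi> \<subseteq> L \<and> derives \<Lambda> {\<phi>} \<chi>}"
  have "\<not> derives \<Lambda> ?\<Gamma> \<psi>"
    using no_interpolant derives_from_consequences derives_singleton by metis
  then obtain v where v: "v \<in> ext_set \<Lambda> ?\<Gamma>" "v \<notin> ext_fm \<Lambda> \<psi>"
    unfolding ext_set_subset_iff_derives[symmetric] by blast
  then obtain u where "u \<in> ext_set \<Lambda> {\<phi>}" "(u, v) \<in> lit_sim \<Lambda> L"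
    using lit_sim_predecessor unfolding ext_set_def by blast
  with v that show ?thesis
    by (auto simp: ext_set_def)
qed


section \<open>The canonical operators\<close>

lemma dia_sigma_ext_fm: "dia_sigma \<Lambda> (ext_fm \<Lambda> \<phi>) = ext_fm \<Lambda> (Dia \<phi>)"
proof
  show "dia_sigma \<Lambda> (ext_fm \<Lambda> \<phi>) \<subseteq> ext_fm \<Lambda> (Dia \<phi>)"
    unfolding dia_sigma_def by blast
next
  have "ext_fm \<Lambda> (Dia \<phi>) \<subseteq> ext_fm \<Lambda> (Dia \<psi>)" if "ext_fm \<Lambda> \<phi> \<subseteq> ext_fm \<Lambda> \<psi>" for \<psi>
    using that imp_Dia_mem by (simp add: ext_fm_subset_iff)
  then show "ext_fm \<Lambda> (Dia \<phi>) \<subseteq> dia_sigma \<Lambda> (ext_fm \<Lambda> \<phi>)"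
    unfolding dia_sigma_def by blast
qed

lemma dia_pi_ext_fm: "dia_pi \<Lambda> (ext_fm \<Lambda> \<phi>) = ext_fm \<Lambda> (Dia \<phi>)"
proof
  show "ext_fm \<Lambda> (Dia \<phi>) \<subseteq> dia_pi \<Lambda> (ext_fm \<Lambda> \<phi>)"
    unfolding dia_pi_def by blast
next
  have compl: "can_worlds \<Lambda> - ext_fm \<Lambda> (neg \<phi>) = ext_fm \<Lambda> \<phi>"
    unfolding ext_fm_neg by (auto simp: ext_set_def)
  have "ext_fm \<Lambda> (Dia \<psi>) \<subseteq> ext_fm \<Lambda> (Dia \<phi>)" if "ext_fm \<Lambda> \<psi> \<subseteq> ext_fm \<Lambda> \<phi>" for \<psi>
    using that imp_Dia_mem by (simp add: ext_fm_subset_iff)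
  then have "(\<Union>\<psi>\<in>{\<psi>. ext_fm \<Lambda> \<psi> \<subseteq> ext_fm \<Lambda> \<phi>}. ext_fm \<Lambda> (Dia \<psi>)) \<subseteq> ext_fm \<Lambda> (Dia \<phi>)"
    by blast
  then show "dia_pi \<Lambda> (ext_fm \<Lambda> \<phi>) \<subseteq> ext_fm \<Lambda> (Dia \<phi>)"
    unfolding dia_pi_def by (intro INF_lower2[of "{neg \<phi>}"]) (simp_all only: compl mem_Collect_eq order_refl)
qed

text \<open>The truth lemma: it depends on the operator only through its values on definable sets, so it
  covers both canonical frames.\<close>

lemma ext_canonical:
  assumes "worlds F = can_worlds \<Lambda>" "\<And>\<phi>. dia F (ext_fm \<Lambda> \<phi>) = ext_fm \<Lambda> (Dia \<phi>)"
  shows "ext F (\<lambda>p. ext_fm \<Lambda> (Pos p)) \<phi> = ext_fm \<Lambda> \<phi>"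
proof (induction \<phi>)
  case (Neg p)
  show ?case
    unfolding ext.simps assms(1) ext_fm_neg[symmetric] by simp
next
  case (Box \<phi>)
  have "ext F (\<lambda>p. ext_fm \<Lambda> (Pos p)) (Box \<phi>) = can_worlds \<Lambda> - dia F (ext_fm \<Lambda> (neg \<phi>))"
    unfolding ext.simps box_def Box assms(1) ext_fm_neg ..
  also have "\<dots> = ext_fm \<Lambda> (neg (Dia (neg \<phi>)))"
    by (simp only: assms(2) ext_fm_neg[of "Dia (neg \<phi>)"])
  finally show ?case
    by simp
next
  case (Dia \<phi>)
  then show ?case
    by (simp add: assms(2))
next
  case (And \<phi> \<psi>)
  show ?case
    unfolding ext.simps And by (auto simp: ext_set_def world_And)
next
  case (Or \<phi> \<psi>)
  show ?case
    unfolding ext.simps Or by (auto simp: ext_set_def world_Or)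
next
  case Bot
  show ?case
    by (auto simp: ext_set_def world_Bot)
next
  case Top
  show ?case
    by (auto simp: assms(1) ext_set_def world_Top)
qed simp

lemma logic_frame_monotone:
  assumes "logic_frame \<Lambda> F"
  shows "monotone_frame F"
  unfolding monotone_frame_def
proof (intro conjI allI impI)
  show nbhd: "nbhd_frame F"
    using assms by (simp add: logic_frame_def)
  fix X Y
  assume XY: "X \<subseteq> Y" "Y \<subseteq> worlds F"
  let ?\<theta> = "\<lambda>p::nat. if p = 0 then X else Y"
  have "imp (Dia (Pos 0)) (Dia (Or (Pos 0) (Pos 1))) \<in> \<Lambda>"
    using monotone by (simp add: monotone_logic_def)
  then have valid: "valid_in F (imp (Dia (Pos 0)) (Dia (Or (Pos 0) (Pos 1))))"
    using assms unfolding logic_frame_def by blast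
  have "ext F ?\<theta> (imp (Dia (Pos 0)) (Dia (Or (Pos 0) (Pos 1)))) = worlds F"
    by (rule valid[unfolded valid_in_def, rule_format]) (use XY in auto)
  moreover have "worlds F - (worlds F - X) = X" "X \<union> Y = Y"
    using XY by blast+
  ultimately have "(worlds F - dia F X) \<union> dia F Y = worlds F"
    by (simp add: imp_def box_def)
  moreover have "dia F X \<subseteq> worlds F"
    using XY nbhd unfolding nbhd_frame_def by (meson order_trans)
  ultimately show "dia F X \<subseteq> dia F Y"
    by blast
qed

end


section \<open>Valuations on a product\<close>

lemma dia_subset_worlds: "nbhd_frame F \<Longrightarrow> X \<subseteq> worlds F \<Longrightarrow> dia F X \<subseteq> worlds F"
  by (simp add: nbhd_frame_def)

lemma dia_mono: "monotone_frame F \<Longrightarrow> X \<subseteq> Y \<Longrightarrow> Y \<subseteq> worlds F \<Longrightarrow> dia F X \<subseteq> dia F Y"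
  by (simp add: monotone_frame_def)

lemma box_mono:
  assumes "monotone_frame F" "X \<subseteq> Y"
  shows "box F X \<subseteq> box F Y"
  unfolding box_def using assms by (intro Diff_mono dia_mono) auto

lemma ext_subset_worlds:
  assumes "nbhd_frame F" "\<And>p. \<theta> p \<subseteq> worlds F"
  shows "ext F \<theta> \<phi> \<subseteq> worlds F"
proof (induction \<phi>)
  case (Pos p)
  show ?case
    using assms(2) by simp
next
  case (Dia \<phi>)
  then show ?case
    using dia_subset_worlds[OF assms(1)] by simp
qed (auto simp: box_def)

lemma ext_neg:
  assumes "nbhd_frame F" "\<And>p. \<theta> p \<subseteq> worlds F"
  shows "ext F \<theta> (neg \<phi>) = worlds F - ext F \<theta> \<phi>"
proof (induction \<phi>)
  case (Neg p)
  show ?case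
    using assms(2)[of p] by (simp add: double_diff)
next
  case (Box \<phi>)
  have "dia F (worlds F - ext F \<theta> \<phi>) \<subseteq> worlds F"
    by (rule dia_subset_worlds[OF assms(1)]) blast
  with Box show ?case
    by (simp add: box_def double_diff)
next
  case (Dia \<phi>)
  have "ext F \<theta> \<phi> \<subseteq> worlds F"
    by (rule ext_subset_worlds[OF assms])
  with Dia show ?case
    by (simp add: box_def double_diff)
qed auto

text \<open>The last two hypotheses are inclusions for the extensions of literals: a formula in negation
  normal form is built monotonically from the literals occurring in it.\<close>

lemma ext_mono_lits:
  assumes F: "monotone_frame F" and \<theta>: "\<And>p. \<theta> p \<subseteq> worlds F" "\<And>p. \<eta> p \<subseteq> worlds F"
    and "\<And>p. Pos p \<in> lits \<phi> \<Longrightarrow> \<theta> p \<subseteq> \<eta> p"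
    and "\<And>p. Neg p \<in> lits \<phi> \<Longrightarrow> \<eta> p \<subseteq> \<theta> p"
  shows "ext F \<theta> \<phi> \<subseteq> ext F \<eta> \<phi>"
  using assms(4,5)
proof (induction \<phi>)
  case (Dia \<phi>)
  moreover have "ext F \<eta> \<phi> \<subseteq> worlds F"
    using F \<theta>(2) by (intro ext_subset_worlds) (simp_all add: monotone_frame_def)
  ultimately show ?case
    using dia_mono[OF F] by simp
next
  case (Box \<phi>)
  then show ?case
    using box_mono[OF F] by simp
next
  case (And \<phi> \<psi>)
  then have "ext F \<theta> \<phi> \<subseteq> ext F \<eta> \<phi>" "ext F \<theta> \<psi> \<subseteq> ext F \<eta> \<psi>"
    by simp_all
  then show ?case
    by auto
next
  case (Or \<phi> \<psi>)
  then have "ext F \<theta> \<phi> \<subseteq> ext F \<eta> \<phi>" "ext F \<theta> \<psi> \<subseteq> ext F \<eta> \<psi>"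
    by simp_all
  then show ?case
    by auto
qed auto

text \<open>Preimages commute with the Boolean operations, so commuting with \<open>\<Diamond>\<close> suffices; the projections
  of a bisimulation product are of this kind.\<close>

lemma ext_preimage:
  assumes "nbhd_frame F" "nbhd_frame G" "\<And>z. z \<in> worlds G \<Longrightarrow> f z \<in> worlds F"
    and dia: "\<And>X. X \<subseteq> worlds F \<Longrightarrow> dia G {z \<in> worlds G. f z \<in> X} = {z \<in> worlds G. f z \<in> dia F X}"
    and \<theta>: "\<And>p. \<theta> p \<subseteq> worlds F"
  shows "ext G (\<lambda>p. {z \<in> worlds G. f z \<in> \<theta> p}) \<phi> = {z \<in> worlds G. f z \<in> ext F \<theta> \<phi>}"
proof (induction \<phi>)
  case (Dia \<phi>)
  have "ext F \<theta> \<phi> \<subseteq> worlds F"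
    by (rule ext_subset_worlds[OF assms(1) \<theta>])
  from dia[OF this] Dia show ?case
    by simp
next
  case (Box \<phi>)
  have "worlds G - {z \<in> worlds G. f z \<in> ext F \<theta> \<phi>} = {z \<in> worlds G. f z \<in> worlds F - ext F \<theta> \<phi>}"
    using assms(3) by auto
  with Box show ?case
    using dia[of "worlds F - ext F \<theta> \<phi>"] assms(3) by (auto simp: box_def)
qed (use assms(3) in auto)


section \<open>Lyndon interpolation\<close>

text \<open>The bounds that \<open>\<phi>\<close> and \<open>\<psi>\<close> impose on \<open>V p\<close> are compatible: a lower and an upper bound from the
  same formula coincide, and a lower bound from one formula together with an upper bound from the
  other means that the literal concerned is in \<open>L\<close>. The union of the lower bounds is therefore a
  solution.\<close>

lemma LIP_if_bisimulation_canonical: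
  assumes monotone: "monotone_logic \<Lambda>"
    and F: "logic_frame \<Lambda> F" "worlds F = can_worlds \<Lambda>"
    and dia: "\<And>\<phi>. dia F (ext_fm \<Lambda> \<phi>) = ext_fm \<Lambda> (Dia \<phi>)"
    and forth: "\<And>L X. X \<subseteq> can_worlds \<Lambda> \<Longrightarrow> lit_sim \<Lambda> L `` dia F X \<subseteq> dia F (lit_sim \<Lambda> L `` X)"
    and preserved: "preserved_bisim_products TYPE(fm set) \<Lambda>"
  shows "LIP \<Lambda>"
  unfolding LIP_def
proof (intro allI impI, rule ccontr)
  fix \<phi> \<psi>
  assume imp: "imp \<phi> \<psi> \<in> \<Lambda>"
  define L where "L = lits \<phi> \<inter> lits \<psi>"
  assume "\<not> (\<exists>\<iota>. lits \<iota> \<subseteq> lits \<phi> \<inter> lits \<psi> \<and> imp \<phi> \<iota> \<in> \<Lambda> \<and> imp \<iota> \<psi> \<in> \<Lambda>)"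
  then obtain u v where uv: "(u, v) \<in> lit_sim \<Lambda> L" "\<phi> \<in> u" "\<psi> \<notin> v"
    using separating_pair[OF monotone, of L \<phi> \<psi>] unfolding L_def by blast
  let ?Z = "lit_sim \<Lambda> L"
  have Z_worlds: "fst z \<in> can_worlds \<Lambda>" "snd z \<in> can_worlds \<Lambda>" if "z \<in> ?Z" for z
    using that by (auto simp: lit_sim_def)
  have Z_lits: "\<chi> \<in> fst z \<Longrightarrow> \<chi> \<in> snd z" if "z \<in> ?Z" "lits \<chi> \<subseteq> L" for z \<chi>
    using that by (auto simp: lit_sim_def)
  have Z_lit: "Pos p \<in> snd z" if "z \<in> ?Z" "Pos p \<in> L" "Pos p \<in> fst z" for z p
    using Z_lits[of z "Pos p"] that by simp
  have Z_neg_lit: "Pos p \<in> fst z" if "z \<in> ?Z" "Neg p \<in> L" "Pos p \<in> snd z" for z p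
    using Z_lits[of z "Neg p"] that world_neg[OF monotone Z_worlds(1)[OF that(1)], of "Pos p"]
      world_neg[OF monotone Z_worlds(2)[OF that(1)], of "Pos p"]
    by auto
  have "bisimulation ?Z F F"
    unfolding bisimulation_def lit_sim_converse[OF monotone] F(2)
    using forth logic_frame_monotone[OF monotone F(1)] Z_worlds by auto
  moreover have "(w, w) \<in> ?Z" if "w \<in> can_worlds \<Lambda>" for w
    using that by (simp add: lit_sim_def)
  ultimately have "full_bisimulation ?Z F F"
    unfolding full_bisimulation_def F(2) using Z_worlds by fastforce
  then obtain D where D: "bisim_product (?Z, D) ?Z F F" "logic_frame \<Lambda> (?Z, D)"
    using preserved[unfolded preserved_bisim_products_def, rule_format, OF F(1) F(1)] by blast
  let ?G = "(?Z, D)"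
  let ?\<theta> = "\<lambda>p. ext_fm \<Lambda> (Pos p)"
  let ?\<theta>1 = "\<lambda>p. {z \<in> ?Z. fst z \<in> ?\<theta> p}"
  let ?\<theta>2 = "\<lambda>p. {z \<in> ?Z. snd z \<in> ?\<theta> p}"
  have nbhd: "nbhd_frame F" "nbhd_frame ?G"
    using F(1) D(2) by (simp_all add: logic_frame_def)
  have \<theta>: "?\<theta> p \<subseteq> worlds F" for p
    by (auto simp: F(2) ext_set_def)
  have fst_ext: "ext ?G ?\<theta>1 \<chi> = {z \<in> ?Z. \<chi> \<in> fst z}" for \<chi>
  proof -
    have "ext ?G (\<lambda>p. {z \<in> worlds ?G. fst z \<in> ?\<theta> p}) \<chi> = {z \<in> worlds ?G. fst z \<in> ext F ?\<theta> \<chi>}"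
      by (rule ext_preimage[OF nbhd]) (use D(1) Z_worlds(1) \<theta> in \<open>simp_all add: bisim_product_def F(2)\<close>)
    also have "\<dots> = {z \<in> ?Z. \<chi> \<in> fst z}"
      unfolding ext_canonical[OF monotone F(2) dia] using Z_worlds(1) by (auto simp: ext_set_def)
    finally show ?thesis
      unfolding fst_conv .
  qed
  have snd_ext: "ext ?G ?\<theta>2 \<chi> = {z \<in> ?Z. \<chi> \<in> snd z}" for \<chi>
  proof -
    have "ext ?G (\<lambda>p. {z \<in> worlds ?G. snd z \<in> ?\<theta> p}) \<chi> = {z \<in> worlds ?G. snd z \<in> ext F ?\<theta> \<chi>}"
      by (rule ext_preimage[OF nbhd]) (use D(1) Z_worlds(2) \<theta> in \<open>simp_all add: bisim_product_def F(2)\<close>)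
    also have "\<dots> = {z \<in> ?Z. \<chi> \<in> snd z}"
      unfolding ext_canonical[OF monotone F(2) dia] using Z_worlds(2) by (auto simp: ext_set_def)
    finally show ?thesis
      unfolding fst_conv .
  qed
  define V where
    "V = (\<lambda>p. (if Pos p \<in> lits \<phi> then ?\<theta>1 p else {}) \<union> (if Neg p \<in> lits \<psi> then ?\<theta>2 p else {}))"
  have V: "V p \<subseteq> ?Z" for p
    by (auto simp: V_def)
  have G: "monotone_frame ?G"
    by (rule logic_frame_monotone[OF monotone D(2)])
  have "ext ?G ?\<theta>1 \<phi> \<subseteq> ext ?G V \<phi>"
  proof (rule ext_mono_lits[OF G])
    show "?\<theta>1 p \<subseteq> V p" if "Pos p \<in> lits \<phi>" for p
      using that by (auto simp: V_def)
    show "V p \<subseteq> ?\<theta>1 p" if "Neg p \<in> lits \<phi>" for p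
      using that Z_neg_lit Z_worlds by (auto simp: V_def L_def ext_set_def)
  qed (use V in auto)
  then have "(u, v) \<in> ext ?G V \<phi>"
    using uv unfolding fst_ext by auto
  moreover have "ext ?G V \<psi> \<subseteq> ext ?G ?\<theta>2 \<psi>"
  proof (rule ext_mono_lits[OF G])
    show "V p \<subseteq> ?\<theta>2 p" if "Pos p \<in> lits \<psi>" for p
      using that Z_lit Z_worlds by (auto simp: V_def L_def ext_set_def)
    show "?\<theta>2 p \<subseteq> V p" if "Neg p \<in> lits \<psi>" for p
      using that by (auto simp: V_def)
  qed (use V in auto)
  then have "(u, v) \<notin> ext ?G V \<psi>"
    using uv unfolding snd_ext by auto
  moreover have "ext ?G V (imp \<phi> \<psi>) = ?Z"
    using imp D(2) V by (simp add: logic_frame_def valid_in_def)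
  ultimately show False
    using uv(1) ext_neg[OF nbhd(2), of V \<phi>] V by (auto simp: imp_def)
qed

theorem theorem5p7:
  fixes \<Lambda> :: "fm set"
  assumes "monotone_logic \<Lambda>"
    and "sigma_canonical \<Lambda> \<or> pi_canonical \<Lambda>"
    and "preserved_bisim_products TYPE(fm set) \<Lambda>"
  shows "LIP \<Lambda>"
  using assms(2)
proof
  assume "sigma_canonical \<Lambda>"
  then have "logic_frame \<Lambda> (frame_sigma \<Lambda>)"
    by (simp add: sigma_canonical_def)
  then show ?thesis
    using assms(1,3) by (intro LIP_if_bisimulation_canonical[of \<Lambda> "frame_sigma \<Lambda>"])
      (simp_all add: frame_sigma_def dia_pi_ext_fm lit_sim_dia_pi)
next
  assume "pi_canonical \<Lambda>"
  then have "logic_frame \<Lambda> (frame_pi \<Lambda>)"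
    by (simp add: pi_canonical_def)
  then show ?thesis
    using assms(1,3) by (intro LIP_if_bisimulation_canonical[of \<Lambda> "frame_pi \<Lambda>"])
      (simp_all add: frame_pi_def dia_sigma_ext_fm lit_sim_dia_sigma)
qed

end
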